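(* Let $B=5$, let $\tilde p>0$ be an integer and $\tilde q$ a positive integer with $\tilde q\geqslant 3600\sqrt[3]{|\tilde p|}$. Let $F_2=B^{2}\tilde q^{6}-2B\tilde q^{4}-2B\tilde p\tilde q^{3}-2\tilde q^{2}+2\tilde p\tilde q+\tilde p^{2}-\frac5B-\frac{20}{B^{2}\tilde q^{2}}$. Then there is no integer $t$ with $F_2-\frac{10\tilde p}{B^{2}\tilde q^{3}}<t<F_2$. *)

theory Defs
  imports Complex_Main
begin

definition F2 :: "real \<Rightarrow> real \<Rightarrow> real \<Rightarrow> real" where
  "F2 B p q = B^2 * q^6 - 2 * B * q^4 - 2 * B * p * q^3 - 2 * q^2 + 2 * p * q + p^2
     - 5 / B - 20 / (B^2 * q^2)"

end

theory Submission
  imports Defs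
begin

text \<open>
  If \<open>B\<close> is an integer dividing \<open>5\<close>, then every term of \<open>F2\<close> except the last is an integer, so
  \<open>F2\<close> lies \<open>20 / (B q)\<^sup>2\<close> below some integer \<open>N\<close>. Both this defect and the length
  \<open>10 p / (B\<^sup>2 q\<^sup>3)\<close> of the interval are so small that the interval fits between \<open>N - 1\<close>
  and \<open>N\<close>. For \<open>B = 5\<close> this only takes \<open>q \<ge> 1\<close> and \<open>2 p \<le> q\<^sup>3\<close>.
\<close>

lemma no_int_strictly_between_consecutive:
  fixes x y :: "'a :: linordered_idom"
  assumes "of_int (n - 1) \<le> x" and "y \<le> of_int n"
  shows "\<not> (\<exists>t::int. x < of_int t \<and> of_int t < y)"
proof
  assume "\<exists>t::int. x < of_int t \<and> of_int t < y"
  then obtain t :: int where "x < of_int t" and "of_int t < y"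
    by blast
  with assms have "(of_int (n - 1) :: 'a) < of_int t" and "(of_int t :: 'a) < of_int n"
    by (blast intro: le_less_trans less_le_trans)+
  then show False
    unfolding of_int_less_iff by linarith
qed

lemma power_mult_le_power_of_mult_root_le:
  fixes c x y :: real
  assumes "0 < n" and "0 \<le> c" and "0 \<le> x" and "c * root n x \<le> y"
  shows "c ^ n * x \<le> y ^ n"
proof -
  have "c ^ n * x = (c * root n x) ^ n"
    using assms by (simp add: power_mult_distrib)
  also have "\<dots> \<le> y ^ n"
    using assms by (intro power_mono mult_nonneg_nonneg real_root_ge_zero)
  finally show ?thesis .
qed

definition F2_integral_part :: "int \<Rightarrow> int \<Rightarrow> int \<Rightarrow> int" where
  "F2_integral_part b p q = b^2 * q^6 - 2 * b * q^4 - 2 * b * p * q^3 - 2 * q^2 + 2 * p * q + p^2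
     - 5 div b"

lemma F2_of_int_eq:
  assumes "b dvd 5"
  shows "F2 (of_int b) (of_int p) (of_int q) =
    of_int (F2_integral_part b p q) - 20 / (of_int b * of_int q)^2"
proof -
  have "real_of_int (5 div b) = 5 / of_int b"
    using real_of_int_div[OF assms] by simp
  then show ?thesis
    by (simp add: F2_def F2_integral_part_def power_mult_distrib)
qed

lemma no_int_just_below_F2:
  fixes b p q :: int
  assumes "b dvd 5" and "0 < q" and "5 \<le> \<bar>b * q\<bar>" and "50 * p \<le> b^2 * q^3"
  defines "f \<equiv> F2 (of_int b) (of_int p) (of_int q)"
  shows "\<not> (\<exists>t::int. f - 10 * of_int p / ((of_int b)^2 * (of_int q)^3) < of_int t
    \<and> of_int t < f)"
proof (rule no_int_strictly_between_consecutive)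
  let ?defect = "20 / (real_of_int b * of_int q)^2"
  let ?length = "10 * real_of_int p / ((of_int b)^2 * (of_int q)^3)"
  let ?N = "F2_integral_part b p q"
  have f_eq: "f = of_int ?N - ?defect"
    unfolding f_def by (rule F2_of_int_eq[OF \<open>b dvd 5\<close>])
  show "f \<le> of_int ?N"
    unfolding f_eq by simp
  have "5\<^sup>2 \<le> (b * q)\<^sup>2"
    using \<open>5 \<le> \<bar>b * q\<bar>\<close> abs_le_square_iff[of 5 "b * q"] by simp
  then have "25 \<le> (real_of_int b * of_int q)\<^sup>2"
    using of_int_le_iff[of 25 "(b * q)\<^sup>2", where 'a = real] by simp
  then have defect_le: "?defect \<le> 4/5"
    by (simp add: divide_simps)
  have "b \<noteq> 0"
    using \<open>b dvd 5\<close> by auto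
  then have "0 < (real_of_int b)^2 * (of_int q)^3"
    using \<open>0 < q\<close> by simp
  moreover have "50 * real_of_int p \<le> (of_int b)^2 * (of_int q)^3"
    using of_int_le_iff[of "50 * p" "b^2 * q^3", where 'a = real] \<open>50 * p \<le> b^2 * q^3\<close> by simp
  ultimately have "?length \<le> 1/5"
    by (simp add: pos_divide_le_eq)
  with defect_le show "of_int (?N - 1) \<le> f - ?length"
    unfolding f_eq of_int_diff of_int_1 by linarith
qed

theorem theorem7p6:
  fixes B :: real and p q :: int
  assumes "B = 5"
    and "p > 0"
    and "q > 0"
    and "real_of_int q \<ge> 3600 * root 3 \<bar>real_of_int p\<bar>"
  shows "\<not> (\<exists>t::int. F2 B (real_of_int p) (real_of_int q)
                 - 10 * real_of_int p / (B^2 * (real_of_int q)^3) < real_of_int t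
               \<and> real_of_int t < F2 B (real_of_int p) (real_of_int q))"
proof -
  have "3600 ^ 3 * \<bar>real_of_int p\<bar> \<le> (real_of_int q) ^ 3"
    using assms(4) by (intro power_mult_le_power_of_mult_root_le) simp_all
  then have "real_of_int (3600 ^ 3 * \<bar>p\<bar>) \<le> real_of_int (q ^ 3)"
    by simp
  then have "3600 ^ 3 * \<bar>p\<bar> \<le> q ^ 3"
    unfolding of_int_le_iff .
  then have "50 * p \<le> 5\<^sup>2 * q ^ 3"
    using \<open>p > 0\<close> by simp
  then show ?thesis
    using no_int_just_below_F2[of 5 q p] \<open>q > 0\<close> \<open>B = 5\<close> by simp
qed

end
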